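(* Let $G$ be a graph. Let $\omega(G)$ be the size of the largest clique of $G$ and $\mathrm{tw}(G)$ the treewidth of $G$, as defined in the context. Then \[1-\frac{2}{\omega(G)} \le \epsilon^{-}(G) \le 1-\frac{2}{\mathrm{tw}(G) + 1}.\]
   Context: All graphs are finite, undirected, without multiple edges, and by convention every loop $\{i,i\}$ is an edge (loops are ignored when speaking of cycles and chordality). A graph is chordal if it has no induced cycle with at least 4 vertices. A clique is a set of pairwise adjacent vertices, and the clique number of a graph is the size of its largest clique. The treewidth $\mathrm{tw}(G)$ is here defined to be the smallest possible clique number of a chordal graph having $G$ as a subgraph. A $G$-partial matrix is a symmetric real array $X$ with entries $X_{ij}=X_{ji}$ specified exactly for $\{i,j\}\in E(G)$ (including all diagonal entries); the vector space of these is $\mathrm{Sym}(G)$. $\mathcal{S}(G)\subseteq \mathrm{Sym}(G)$ is the cone of PSD-completable partial matrices, i.e. those whose unspecified entries can be chosen to give a positive semidefinite (PSD) matrix. $\mathcal{P}^-(G)$ is the set of $X\in\mathrm{Sym}(G)$ such that for every $\{i,j\}\in E(G)$ (loops included) the principal submatrix $X|_{\{i,j\}}$ is PSD. Let $\mathrm{tr}(X)=\sum_i X_{ii}$ and let $I_G$ be the projection of the identity matrix to $\mathrm{Sym}(G)$. Define $\epsilon_G(X)=\min\{\epsilon : X+\epsilon I_G\in\mathcal{S}(G)\}$ and $\epsilon^-(G)=\max\{\epsilon_G(X):X\in\mathcal{P}^-(G),\ \mathrm{tr}(X)=1\}$. *)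

theory Defs
  imports Complex_Main "HOL-Library.Ramsey"
begin

text \<open>
  A graph is given by its vertex set \<open>V\<close> and its edge set \<open>E\<close>, whose elements are the sets
  \<open>{i, j}\<close>. All loops \<open>{i, i} = {i}\<close> with \<open>i \<in> V\<close> belong to \<open>E\<close>.
\<close>

definition graph :: "'a set \<Rightarrow> 'a set set \<Rightarrow> bool" where
  "graph V E \<longleftrightarrow> finite V \<and> (\<forall>e\<in>E. \<exists>i\<in>V. \<exists>j\<in>V. e = {i, j}) \<and> (\<forall>i\<in>V. {i, i} \<in> E)"

definition subgraph :: "'a set \<Rightarrow> 'a set set \<Rightarrow> 'a set \<Rightarrow> 'a set set \<Rightarrow> bool" where
  "subgraph V E W F \<longleftrightarrow> V \<subseteq> W \<and> E \<subseteq> F"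

text \<open>
  The cyclic list \<open>c\<close> of distinct vertices is an induced cycle if its only edges, apart from
  loops, join cyclically consecutive vertices.
\<close>

definition induced_cycle :: "'a set \<Rightarrow> 'a set set \<Rightarrow> 'a list \<Rightarrow> bool" where
  "induced_cycle V E c \<longleftrightarrow>
     3 \<le> length c \<and> distinct c \<and> set c \<subseteq> V \<and>
     (\<forall>i<length c. \<forall>j<length c. i \<noteq> j \<longrightarrow>
        ({c ! i, c ! j} \<in> E \<longleftrightarrow> j = Suc i mod length c \<or> i = Suc j mod length c))"

definition chordal :: "'a set \<Rightarrow> 'a set set \<Rightarrow> bool" where
  "chordal V E \<longleftrightarrow> \<not> (\<exists>c. induced_cycle V E c \<and> 4 \<le> length c)"

definition clique_number :: "'a set \<Rightarrow> 'a set set \<Rightarrow> nat" where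
  "clique_number V E = Max (card ` {K. K \<subseteq> V \<and> clique K E})"

text \<open>
  With this convention the treewidth is not decreased by one: a forest with at least one
  proper edge has treewidth 2.
\<close>

definition treewidth :: "'a set \<Rightarrow> 'a set set \<Rightarrow> nat" where
  "treewidth V E =
     (LEAST k. \<exists>W F. graph W F \<and> chordal W F \<and> subgraph V E W F \<and> clique_number W F = k)"

text \<open>
  The principal submatrix of \<open>A\<close> with rows and columns indexed by the finite set \<open>K\<close> is
  positive semidefinite.
\<close>

definition psd_on :: "'a set \<Rightarrow> ('a \<Rightarrow> 'a \<Rightarrow> real) \<Rightarrow> bool" where
  "psd_on K A \<longleftrightarrow>
     (\<forall>i\<in>K. \<forall>j\<in>K. A i j = A j i) \<and>
     (\<forall>v::'a \<Rightarrow> real. 0 \<le> (\<Sum>i\<in>K. \<Sum>j\<in>K. v i * A i j * v j))"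

text \<open>
  A partial matrix is represented by the function which agrees with it on the specified
  entries and is \<open>0\<close> elsewhere. The value \<open>0\<close> only makes the representation unique; a
  completion may change it freely.
\<close>

definition partial_sym :: "'a set set \<Rightarrow> ('a \<Rightarrow> 'a \<Rightarrow> real) set" where
  "partial_sym E = {X. (\<forall>i j. X i j = X j i) \<and> (\<forall>i j. {i, j} \<notin> E \<longrightarrow> X i j = 0)}"

definition partial_proj :: "'a set set \<Rightarrow> ('a \<Rightarrow> 'a \<Rightarrow> real) \<Rightarrow> 'a \<Rightarrow> 'a \<Rightarrow> real" where
  "partial_proj E A = (\<lambda>i j. if {i, j} \<in> E then A i j else 0)"

definition partial_id :: "'a set set \<Rightarrow> 'a \<Rightarrow> 'a \<Rightarrow> real" where
  "partial_id E = partial_proj E (\<lambda>i j. if i = j then 1 else 0)"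

definition psd_completable :: "'a set \<Rightarrow> 'a set set \<Rightarrow> ('a \<Rightarrow> 'a \<Rightarrow> real) set" where
  "psd_completable V E =
     {X \<in> partial_sym E. \<exists>Y. (\<forall>i j. {i, j} \<in> E \<longrightarrow> Y i j = X i j) \<and> psd_on V Y}"

definition edgewise_psd :: "'a set set \<Rightarrow> ('a \<Rightarrow> 'a \<Rightarrow> real) set" where
  "edgewise_psd E = {X \<in> partial_sym E. \<forall>i j. {i, j} \<in> E \<longrightarrow> psd_on {i, j} X}"

definition partial_trace :: "'a set \<Rightarrow> ('a \<Rightarrow> 'a \<Rightarrow> real) \<Rightarrow> real" where
  "partial_trace V X = (\<Sum>i\<in>V. X i i)"

text \<open>
  \<open>LEAST\<close> and \<open>GREATEST\<close> denote an attained minimum and maximum, not merely an infimum and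
  a supremum.
\<close>

definition psd_defect :: "'a set \<Rightarrow> 'a set set \<Rightarrow> ('a \<Rightarrow> 'a \<Rightarrow> real) \<Rightarrow> real" where
  "psd_defect V E X =
     (LEAST \<epsilon>. (\<lambda>i j. X i j + \<epsilon> * partial_id E i j) \<in> psd_completable V E)"

definition eps_minus :: "'a set \<Rightarrow> 'a set set \<Rightarrow> real" where
  "eps_minus V E =
     (GREATEST \<epsilon>. \<exists>X\<in>edgewise_psd E. partial_trace V X = 1 \<and> \<epsilon> = psd_defect V E X)"

end

theory Submission
  imports Defs "HOL-Analysis.Function_Topology" "HOL-Analysis.Convex"
begin

text \<open>
  Lower bound: on a maximum clique take \<open>(2 I - J) / \<omega>\<close>, with \<open>J\<close> the all-ones matrix, and zero
  elsewhere. The clique block is fully specified and has least eigenvalue \<open>2 / \<omega> - 1\<close>.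

  Upper bound: extend \<open>X\<close> by zeros to a chordal supergraph \<open>H\<close> with clique number \<open>k\<close>. A partial
  matrix on a chordal graph is completable as soon as its clique submatrices are PSD, because a
  simplicial vertex can be added to an existing completion. On a clique, \<open>|X\<^sub>i\<^sub>j| \<le> q\<^sub>i q\<^sub>j\<close> with
  \<open>q\<^sub>i\<^sup>2 = X\<^sub>i\<^sub>i\<close> reduces \<open>X + \<epsilon> I \<succeq> 0\<close> to \<open>q q\<^sup>T \<preceq> 2 diag(q\<^sup>2) + \<epsilon> I\<close>, which follows from
  Cauchy--Schwarz and the concavity of \<open>t / (2 t + \<epsilon>)\<close> for \<open>\<epsilon> = 1 - 2 / n\<close>, \<open>n \<ge> max 2 k\<close>. Taking
  \<open>n = k + 1\<close> keeps \<open>n \<ge> 2\<close> when \<open>k = 1\<close>.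

  The minimum and the maximum in the definitions are attained by compactness in the product
  topology on matrices.
\<close>

subsection \<open>Positive semidefinite matrices\<close>

definition quad :: "'a set \<Rightarrow> ('a \<Rightarrow> 'a \<Rightarrow> real) \<Rightarrow> ('a \<Rightarrow> real) \<Rightarrow> real" where
  "quad K A v = (\<Sum>i\<in>K. \<Sum>j\<in>K. v i * A i j * v j)"

lemma psd_on_quad:
  "psd_on K A \<longleftrightarrow> (\<forall>i\<in>K. \<forall>j\<in>K. A i j = A j i) \<and> (\<forall>v. 0 \<le> quad K A v)"
  by (simp add: psd_on_def quad_def)

lemma psd_on_sym: "psd_on K A \<Longrightarrow> i \<in> K \<Longrightarrow> j \<in> K \<Longrightarrow> A i j = A j i"
  unfolding psd_on_def by blast

lemma psd_on_quad_nonneg: "psd_on K A \<Longrightarrow> 0 \<le> quad K A v"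
  by (simp add: psd_on_quad)

lemma quad_cong:
  assumes "\<And>i j. i \<in> K \<Longrightarrow> j \<in> K \<Longrightarrow> A i j = B i j" "\<And>i. i \<in> K \<Longrightarrow> v i = w i"
  shows "quad K A v = quad K B w"
  unfolding quad_def by (intro sum.cong refl) (simp add: assms)

lemma psd_on_cong:
  assumes "\<And>i j. i \<in> K \<Longrightarrow> j \<in> K \<Longrightarrow> A i j = B i j"
  shows "psd_on K A \<longleftrightarrow> psd_on K B"
proof -
  have "quad K A = quad K B"
    using assms by (intro ext quad_cong) auto
  then show ?thesis
    using assms by (auto simp: psd_on_quad)
qed

lemma quad_zero_outside:
  assumes "finite K" "L \<subseteq> K" "\<And>i. i \<in> K - L \<Longrightarrow> v i = 0"
  shows "quad K A v = quad L A v"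
proof -
  have "(\<Sum>j\<in>K. v i * A i j * v j) = (\<Sum>j\<in>L. v i * A i j * v j)" for i
    by (intro sum.mono_neutral_right) (use assms in auto)
  moreover have "(\<Sum>i\<in>K. \<Sum>j\<in>L. v i * A i j * v j) = (\<Sum>i\<in>L. \<Sum>j\<in>L. v i * A i j * v j)"
    by (intro sum.mono_neutral_right) (use assms in auto)
  ultimately show ?thesis
    by (simp add: quad_def)
qed

lemma psd_on_subset:
  assumes "psd_on K A" "L \<subseteq> K" "finite K"
  shows "psd_on L A"
  unfolding psd_on_quad
proof (intro conjI ballI allI)
  show "A i j = A j i" if "i \<in> L" "j \<in> L" for i j
    using assms that psd_on_sym[OF assms(1), of i j] by blast
next
  fix v :: "'a \<Rightarrow> real"
  let ?w = "\<lambda>i. if i \<in> L then v i else 0"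
  have "quad L A v = quad L A ?w"
    by (rule quad_cong) auto
  also have "\<dots> = quad K A ?w"
    by (rule quad_zero_outside[symmetric]) (use assms in auto)
  finally show "0 \<le> quad L A v"
    using assms(1) by (simp add: psd_on_quad)
qed

lemma quad_insert:
  assumes "finite K" "u \<notin> K" "\<And>i. i \<in> K \<Longrightarrow> A i u = A u i"
  shows "quad (insert u K) A v = A u u * (v u)\<^sup>2 + 2 * v u * (\<Sum>j\<in>K. A u j * v j) + quad K A v"
proof -
  have "(\<Sum>i\<in>K. v i * A i u * v u) = v u * (\<Sum>j\<in>K. A u j * v j)"
    using assms(3) by (simp add: sum_distrib_left mult_ac)
  moreover have "(\<Sum>j\<in>K. v u * A u j * v j) = v u * (\<Sum>j\<in>K. A u j * v j)"
    by (simp add: sum_distrib_left mult_ac)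
  ultimately show ?thesis
    using assms(1,2) by (simp add: quad_def sum.distrib power2_eq_square algebra_simps)
qed

lemma quad_add_scaled:
  assumes "\<And>i j. i \<in> K \<Longrightarrow> j \<in> K \<Longrightarrow> A i j = A j i"
  shows "quad K A (\<lambda>i. w i + c * z i) =
    quad K A w + 2 * c * (\<Sum>i\<in>K. w i * (\<Sum>j\<in>K. A i j * z j)) + c\<^sup>2 * quad K A z"
proof -
  have 1: "(\<Sum>i\<in>K. \<Sum>j\<in>K. w i * A i j * z j) = (\<Sum>i\<in>K. w i * (\<Sum>j\<in>K. A i j * z j))"
    by (simp add: sum_distrib_left mult_ac)
  have "(\<Sum>i\<in>K. \<Sum>j\<in>K. z i * A i j * w j) = (\<Sum>j\<in>K. \<Sum>i\<in>K. z i * A i j * w j)"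
    by (rule sum.swap)
  also have "\<dots> = (\<Sum>i\<in>K. \<Sum>j\<in>K. w i * A i j * z j)"
    by (intro sum.cong refl) (simp add: assms mult_ac)
  finally have 2: "(\<Sum>i\<in>K. \<Sum>j\<in>K. z i * A i j * w j) = (\<Sum>i\<in>K. w i * (\<Sum>j\<in>K. A i j * z j))"
    using 1 by simp
  have "quad K A (\<lambda>i. w i + c * z i) =
      (\<Sum>i\<in>K. \<Sum>j\<in>K. w i * A i j * w j + c * (w i * A i j * z j) +
        c * (z i * A i j * w j) + c\<^sup>2 * (z i * A i j * z j))"
    unfolding quad_def by (intro sum.cong refl) (simp add: algebra_simps power2_eq_square)
  also have "\<dots> = quad K A w + c * (\<Sum>i\<in>K. \<Sum>j\<in>K. w i * A i j * z j) +
      c * (\<Sum>i\<in>K. \<Sum>j\<in>K. z i * A i j * w j) + c\<^sup>2 * quad K A z"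
    by (simp add: sum.distrib sum_distrib_left quad_def)
  finally show ?thesis
    using 1 2 by simp
qed

lemma psd_on_diag_nonneg:
  assumes "psd_on K A" "finite K" "i \<in> K"
  shows "0 \<le> A i i"
proof -
  have "psd_on {i} A"
    using assms by (intro psd_on_subset[OF assms(1)]) auto
  then have "0 \<le> quad {i} A (\<lambda>_. 1)"
    by (simp add: psd_on_quad_nonneg)
  then show ?thesis
    by (simp add: quad_def)
qed

text \<open>For fixed \<open>v\<close> on \<open>K\<close>, the form of \<open>A\<close> is a
  quadratic polynomial in the coordinate at \<open>u\<close> with leading coefficient
  \<open>A u u\<close>; its minimum is the form of the Schur complement at \<open>v\<close>.\<close>

lemma psd_on_schur:
  assumes "psd_on (insert u K) A" "finite K" "u \<notin> K" "0 < A u u"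
  shows "psd_on K (\<lambda>i j. A i j - A i u * A u j / A u u)"
  unfolding psd_on_quad
proof (intro conjI ballI allI)
  have sym: "A i j = A j i" if "i \<in> insert u K" "j \<in> insert u K" for i j
    using psd_on_sym[OF assms(1) that] .
  show "A i j - A i u * A u j / A u u = A j i - A j u * A u i / A u u" if "i \<in> K" "j \<in> K" for i j
    using that sym[of i j] sym[of i u] sym[of j u] by simp
  fix v :: "'a \<Rightarrow> real"
  define s where "s = (\<Sum>j\<in>K. A u j * v j)"
  \<comment> \<open>The coordinate at \<open>u\<close> is put at the minimiser of this
    polynomial.\<close>
  let ?w = "v(u := - s / A u u)"
  have "quad K (\<lambda>i j. A i j - A i u * A u j / A u u) v =
      (\<Sum>i\<in>K. \<Sum>j\<in>K. v i * A i j * v j - (A u i * v i) * (A u j * v j) / A u u)"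
    unfolding quad_def using sym by (intro sum.cong refl) (simp add: algebra_simps)
  also have "\<dots> = quad K A v - s * s / A u u"
    unfolding quad_def s_def sum_product by (simp add: sum_subtractf sum_divide_distrib)
  finally have 1: "quad K (\<lambda>i j. A i j - A i u * A u j / A u u) v = quad K A v - s * s / A u u" .
  have "(\<Sum>j\<in>K. A u j * ?w j) = s"
    unfolding s_def by (intro sum.cong refl) (use assms(3) in auto)
  moreover have "quad K A ?w = quad K A v"
    by (rule quad_cong) (use assms(3) in auto)
  ultimately have "quad (insert u K) A ?w =
      A u u * (s / A u u)\<^sup>2 + 2 * (- s / A u u) * s + quad K A v"
    using quad_insert[OF assms(2,3), of A ?w] sym by simp
  also have "\<dots> = quad K A v - s * s / A u u"
    using assms(4) by (simp add: power2_eq_square field_simps)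
  finally show "0 \<le> quad K (\<lambda>i j. A i j - A i u * A u j / A u u) v"
    using 1 psd_on_quad_nonneg[OF assms(1)] by metis
qed

text \<open>The two by two minor is nonnegative: with a positive pivot \<open>A i i\<close> it is
  \<open>A i i\<close> times the one-entry Schur complement, and a zero pivot forces
  \<open>A i j = 0\<close>.\<close>

lemma psd_on_entry_bound:
  assumes "psd_on K A" "finite K" "i \<in> K" "j \<in> K"
  shows "(A i j)\<^sup>2 \<le> A i i * A j j"
proof (cases "i = j")
  case False
  have sub: "psd_on {i, j} A"
    using assms by (intro psd_on_subset[OF assms(1)]) auto
  have sym: "A i j = A j i"
    using psd_on_sym[OF assms(1,3,4)] .
  show ?thesis
  proof (cases "A i i = 0")
    case True
    \<comment> \<open>If \<open>A i j\<close> were nonzero, the form would be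
      \<open>- A j j - 2 < 0\<close> here. For \<open>A i j = 0\<close> the quotient is
      \<open>0\<close> by convention and the form is just \<open>A j j\<close>.\<close>
    let ?v = "(\<lambda>_. 1)(i := - (A j j + 1) / A i j)"
    have "0 \<le> quad {i, j} A ?v"
      using sub by (simp add: psd_on_quad_nonneg)
    also have "quad {i, j} A ?v = 2 * (- (A j j + 1) / A i j) * A i j + A j j"
      using False True sym by (subst quad_insert) (auto simp: quad_def)
    finally have "A i j = 0"
      using psd_on_diag_nonneg[OF assms(1,2,4)] by (cases "A i j = 0") auto
    then show ?thesis
      using True by simp
  next
    case nz: False
    then have pos: "0 < A i i"
      using psd_on_diag_nonneg[OF assms(1-3)] by simp
    have "psd_on {j} (\<lambda>k l. A k l - A k i * A i l / A i i)"
      by (rule psd_on_schur) (use sub False pos in auto)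
    then have "0 \<le> A j j - A j i * A i j / A i i"
      using psd_on_diag_nonneg[of "{j}" "\<lambda>k l. A k l - A k i * A i l / A i i" j] by simp
    then show ?thesis
      using pos sym by (simp add: field_simps power2_eq_square)
  qed
qed (simp add: power2_eq_square)

section \<open>Linear systems with PSD blocks, and extension by one vertex\<close>

text \<open>Positivity of the bordered matrix puts the new column into the range of the block, even
  when the block is singular. The indices \<open>u\<close> are eliminated one at a time as in
  Gaussian elimination; Schur complements preserve positivity.\<close>

lemma psd_on_solvable:
  assumes "finite N" "v \<notin> N" "psd_on (insert v N) M"
  shows "\<exists>z. \<forall>i\<in>N. (\<Sum>j\<in>N. M i j * z j) = M i v"
  using assms
proof (induction N arbitrary: M)
  case (insert u N)
  have fin: "finite (insert v (insert u N))" and u: "u \<noteq> v" "u \<notin> insert v N" and vN: "v \<notin> N"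
    using insert by auto
  have sym: "M i j = M j i" if "i \<in> insert v (insert u N)" "j \<in> insert v (insert u N)" for i j
    using psd_on_sym[OF insert.prems(2) that] .
  have nonneg: "0 \<le> M u u"
    using psd_on_diag_nonneg[OF insert.prems(2) fin] by simp
  show ?case
  proof (cases "M u u = 0")
    case True
    have zero: "M u j = 0" if "j \<in> insert v (insert u N)" for j
      using psd_on_entry_bound[OF insert.prems(2) fin, of u j] that True by simp
    \<comment> \<open>Row and column \<open>u\<close> vanish, so the equation at \<open>u\<close> is
      trivial and the value of \<open>z\<close> at \<open>u\<close> does not enter the
      others.\<close>
    have "psd_on (insert v N) M"
      by (rule psd_on_subset[OF insert.prems(2)]) (use insert in auto)
    then obtain z where z: "\<And>i. i \<in> N \<Longrightarrow> (\<Sum>j\<in>N. M i j * z j) = M i v"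
      using insert.IH[OF vN] by blast
    have "(\<Sum>j\<in>insert u N. M i j * z j) = M i v" if "i \<in> insert u N" for i
    proof (cases "i = u")
      case True
      then show ?thesis
        using zero by (intro trans[OF sum.neutral]) auto
    next
      case False
      then have "i \<in> N" "M i u = 0"
        using that zero[of i] sym[of i u] by auto
      then show ?thesis
        using z insert.hyps by simp
    qed
    then show ?thesis
      by blast
  next
    case False
    then have pos: "0 < M u u"
      using nonneg by simp
    let ?S = "\<lambda>i j. M i j - M i u * M u j / M u u"
    have "psd_on (insert v N) ?S"
      using insert.prems insert.hyps pos u by (intro psd_on_schur) (auto simp: insert_commute)
    then obtain z where z: "\<And>i. i \<in> N \<Longrightarrow> (\<Sum>j\<in>N. ?S i j * z j) = ?S i v"
      using insert.IH[OF vN] by blast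
    define s where "s = (\<Sum>j\<in>N. M u j * z j)"
    \<comment> \<open>Back substitution: the new value at \<open>u\<close> solves the equation at
      \<open>u\<close>.\<close>
    define w where "w = z(u := (M u v - s) / M u u)"
    have sum_w: "(\<Sum>j\<in>N. M i j * w j) = (\<Sum>j\<in>N. M i j * z j)" for i
      by (intro sum.cong refl) (use insert.hyps in \<open>auto simp: w_def\<close>)
    have "(\<Sum>j\<in>insert u N. M i j * w j) = M i v" if "i \<in> insert u N" for i
    proof -
      have 1: "(\<Sum>j\<in>insert u N. M i j * w j) = M i u * (M u v - s) / M u u + (\<Sum>j\<in>N. M i j * z j)"
        using insert.hyps sum_w by (simp add: w_def)
      show ?thesis
      proof (cases "i = u")
        case True
        then show ?thesis
          using 1 pos by (simp add: s_def)
      next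
        case False
        then have "i \<in> N"
          using that by simp
        have "(\<Sum>j\<in>N. ?S i j * z j) = (\<Sum>j\<in>N. M i j * z j) - M i u / M u u * s"
          unfolding s_def by (simp add: algebra_simps sum_subtractf sum_distrib_left sum_divide_distrib)
        with z[OF \<open>i \<in> N\<close>] 1 show ?thesis
          by (simp add: diff_divide_distrib algebra_simps)
      qed
    qed
    then show ?thesis
      by blast
  qed
qed simp

text \<open>
  If \<open>z\<close> solves \<open>X\<^sub>N\<^sub>N z = X\<^sub>N\<^sub>u\<close>, then the new column \<open>Y z\<close> extends the prescribed one.
\<close>
lemma psd_on_add_vertex:
  assumes K: "finite K" "u \<notin> K" "N \<subseteq> K"
    and Y: "psd_on K Y" and X: "psd_on (insert u N) X"
    and agree: "\<And>i j. i \<in> N \<Longrightarrow> j \<in> N \<Longrightarrow> Y i j = X i j"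
  obtains Z where "psd_on (insert u K) Z" "\<And>i j. i \<in> K \<Longrightarrow> j \<in> K \<Longrightarrow> Z i j = Y i j"
    "\<And>i. i \<in> insert u N \<Longrightarrow> Z i u = X i u \<and> Z u i = X u i"
proof -
  have N: "finite N" "u \<notin> N"
    using K finite_subset by auto
  have Xsym: "X i j = X j i" if "i \<in> insert u N" "j \<in> insert u N" for i j
    using psd_on_sym[OF X that] .
  have Ysym: "Y i j = Y j i" if "i \<in> K" "j \<in> K" for i j
    using psd_on_sym[OF Y that] .
  obtain z' where z': "\<And>i. i \<in> N \<Longrightarrow> (\<Sum>j\<in>N. X i j * z' j) = X i u"
    using psd_on_solvable[OF N X] by blast
  define z where "z i = (if i \<in> N then z' i else 0)" for i
  define y where "y i = (\<Sum>j\<in>K. Y i j * z j)" for i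
  have y_eq: "y i = (\<Sum>j\<in>N. Y i j * z' j)" for i
  proof -
    have "y i = (\<Sum>j\<in>N. Y i j * z j)"
      unfolding y_def by (rule sum.mono_neutral_right) (use K in \<open>auto simp: z_def\<close>)
    then show ?thesis
      by (simp add: z_def)
  qed
  have y_N: "y i = X i u" if "i \<in> N" for i
    using y_eq z'[OF that] agree[OF that] by simp
  define s where "s = (\<Sum>j\<in>N. X u j * z' j)"
  have quad_Nz: "quad N X z' = s"
  proof -
    have "quad N X z' = (\<Sum>i\<in>N. z' i * (\<Sum>j\<in>N. X i j * z' j))"
      by (simp add: quad_def sum_distrib_left mult_ac)
    also have "\<dots> = (\<Sum>i\<in>N. z' i * X u i)"
      by (intro sum.cong refl) (simp add: z' Xsym)
    finally show ?thesis
      by (simp add: s_def mult.commute)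
  qed
  have quad_z: "quad K Y z = s"
  proof -
    have "quad K Y z = quad N Y z"
      by (rule quad_zero_outside) (use K in \<open>auto simp: z_def\<close>)
    also have "\<dots> = quad N X z'"
      by (rule quad_cong) (auto simp: z_def agree)
    finally show ?thesis
      using quad_Nz by simp
  qed
  have s_le: "s \<le> X u u"
  proof -
    \<comment> \<open>At \<open>z'\<close> on \<open>N\<close> and -1 at \<open>u\<close> the form
      is \<open>X u u - 2 * s + s\<close>, so its positivity bounds \<open>s\<close>.\<close>
    let ?w = "z'(u := -1)"
    have "0 \<le> quad (insert u N) X ?w"
      using X by (simp add: psd_on_quad_nonneg)
    also have "quad (insert u N) X ?w = X u u - 2 * (\<Sum>j\<in>N. X u j * ?w j) + quad N X ?w"
      using quad_insert[OF N, of X ?w] Xsym by simp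
    also have "(\<Sum>j\<in>N. X u j * ?w j) = s"
      unfolding s_def by (intro sum.cong refl) (use N in auto)
    also have "quad N X ?w = quad N X z'"
      by (rule quad_cong) (use N in auto)
    finally show ?thesis
      using quad_Nz by simp
  qed
  define Z where "Z i j = (if i = u then if j = u then X u u else y j
                           else if j = u then y i else Y i j)" for i j
  show ?thesis
  proof
    show "Z i j = Y i j" if "i \<in> K" "j \<in> K" for i j
      using that K by (auto simp: Z_def)
    show "Z i u = X i u \<and> Z u i = X u i" if "i \<in> insert u N" for i
      using that Xsym[of i u] y_N N by (auto simp: Z_def)
    show "psd_on (insert u K) Z"
      unfolding psd_on_quad
    proof (intro conjI ballI allI)
      show "Z i j = Z j i" if "i \<in> insert u K" "j \<in> insert u K" for i j
        using that Ysym by (auto simp: Z_def)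
      fix w :: "'a \<Rightarrow> real"
      have "(\<Sum>j\<in>K. Z u j * w j) = (\<Sum>i\<in>K. w i * y i)"
        by (intro sum.cong refl) (use K in \<open>auto simp: Z_def\<close>)
      moreover have "quad K Z w = quad K Y w"
        by (rule quad_cong) (use K in \<open>auto simp: Z_def\<close>)
      moreover have "quad (insert u K) Z w =
          Z u u * (w u)\<^sup>2 + 2 * w u * (\<Sum>j\<in>K. Z u j * w j) + quad K Z w"
        by (rule quad_insert) (use K in \<open>auto simp: Z_def\<close>)
      ultimately have "quad (insert u K) Z w =
          X u u * (w u)\<^sup>2 + 2 * w u * (\<Sum>i\<in>K. w i * y i) + quad K Y w"
        by (simp add: Z_def)
      \<comment> \<open>Completing the square: \<open>y\<close> is \<open>Y z\<close>, so shifting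
        \<open>w\<close> along \<open>z\<close> absorbs the mixed terms and leaves the nonnegative
        gap \<open>X u u - s\<close>.\<close>
      also have "\<dots> = quad K Y (\<lambda>i. w i + w u * z i) + (w u)\<^sup>2 * (X u u - s)"
        using quad_add_scaled[OF Ysym, where w = w and c = "w u" and z = z] quad_z
        by (simp add: y_def algebra_simps)
      also have "\<dots> \<ge> 0"
        using Y s_le by (simp add: psd_on_quad_nonneg)
      finally show "0 \<le> quad (insert u K) Z w" .
    qed
  qed
qed

section \<open>Diagonal shifts on a single clique\<close>

text \<open>
  With \<open>r\<^sub>i = (1 - \<epsilon>) / n + \<epsilon> t\<^sub>i\<close>, the tangent line at \<open>t = 1 / n\<close> to the concave function
  \<open>t / (2 t + \<epsilon>)\<close>, one has \<open>r\<^sub>i (2 t\<^sub>i + \<epsilon>) - t\<^sub>i = 2 \<epsilon> (t\<^sub>i - 1 / n)\<^sup>2\<close>.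
\<close>
lemma weighted_square_sum_bound:
  fixes q v :: "'a \<Rightarrow> real"
  assumes K: "finite K" "real (card K) \<le> n" and n: "2 \<le> n"
    and q: "(\<Sum>i\<in>K. (q i)\<^sup>2) \<le> 1"
  shows "(\<Sum>i\<in>K. q i * v i)\<^sup>2 \<le> (\<Sum>i\<in>K. (2 * (q i)\<^sup>2 + (1 - 2 / n)) * (v i)\<^sup>2)"
proof -
  define e where "e = 1 - 2 / n"
  have e: "0 \<le> e" "e < 1" "1 - e = 2 / n"
    using n by (auto simp: e_def field_simps)
  define r where "r i = (1 - e) / n + e * (q i)\<^sup>2" for i
  have r_pos: "0 < r i" for i
    using e n by (auto simp: r_def intro!: add_pos_nonneg divide_pos_pos)
  have "(\<Sum>i\<in>K. r i) = real (card K) / n * (1 - e) + e * (\<Sum>i\<in>K. (q i)\<^sup>2)"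
    by (simp add: r_def sum.distrib sum_distrib_left)
  also have "\<dots> \<le> 1 * (1 - e) + e * 1"
    using K n e q by (intro add_mono mult_mono mult_right_mono mult_left_mono) (auto simp: field_simps)
  finally have sum_r: "(\<Sum>i\<in>K. r i) \<le> 1"
    by simp
  \<comment> \<open>Writing \<open>u\<close> for \<open>1 / n\<close> turns the tangent-line
    identity into a polynomial one.\<close>
  define u where "u = 1 / n"
  have e_u: "e = 1 - 2 * u" and r_u: "r i = 2 * u * u + e * (q i)\<^sup>2" for i
    unfolding r_def e(3) by (simp_all add: e_def u_def)
  have q_le: "(q i)\<^sup>2 \<le> r i * (2 * (q i)\<^sup>2 + e)" for i
  proof -
    have "r i * (2 * (q i)\<^sup>2 + e) - (q i)\<^sup>2 = 2 * e * ((q i)\<^sup>2 - u)\<^sup>2"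
      unfolding r_u e_u by algebra
    then show ?thesis
      using e by (smt (verit) mult_nonneg_nonneg zero_le_power2)
  qed
  \<comment> \<open>Cauchy-Schwarz with the weights \<open>r\<close>, whose total is at most 1;
    splitting off \<open>sqrt (r i)\<close> leaves the quotients \<open>(q i)^2 / r i\<close>, which
    \<open>q_le\<close> controls.\<close>
  have "(\<Sum>i\<in>K. q i * v i)\<^sup>2 = (\<Sum>i\<in>K. sqrt (r i) * (q i * v i / sqrt (r i)))\<^sup>2"
  proof -
    have "sqrt (r i) \<noteq> 0" for i
      using r_pos[of i] by simp
    then show ?thesis
      by simp
  qed
  also have "\<dots> \<le> (\<Sum>i\<in>K. (sqrt (r i))\<^sup>2) * (\<Sum>i\<in>K. (q i * v i / sqrt (r i))\<^sup>2)"
    by (rule Cauchy_Schwarz_ineq_sum)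
  also have "\<dots> \<le> 1 * (\<Sum>i\<in>K. (q i * v i / sqrt (r i))\<^sup>2)"
    using sum_r r_pos by (intro mult_right_mono sum_nonneg) (auto simp: less_imp_le)
  also have "\<dots> \<le> (\<Sum>i\<in>K. (2 * (q i)\<^sup>2 + e) * (v i)\<^sup>2)"
    unfolding mult_1
  proof (rule sum_mono)
    fix i
    have "(q i * v i / sqrt (r i))\<^sup>2 = (q i)\<^sup>2 / r i * (v i)\<^sup>2"
      using r_pos[of i] by (simp add: power_divide power_mult_distrib)
    also have "\<dots> \<le> (2 * (q i)\<^sup>2 + e) * (v i)\<^sup>2"
      using q_le[of i] r_pos[of i] by (intro mult_right_mono) (auto simp: field_simps)
    finally show "(q i * v i / sqrt (r i))\<^sup>2 \<le> (2 * (q i)\<^sup>2 + e) * (v i)\<^sup>2" .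
  qed
  finally show ?thesis
    by (simp add: e_def)
qed

text \<open>Off the diagonal the worst entry contributes \<open>- q i * q j\<close> times
  \<open>|v i| * |v j|\<close>. Subtracting the whole rank-one form also removes
  \<open>(q i)^2 * (v i)^2\<close> on the diagonal, which is why \<open>?D\<close> carries the
  factor 2.\<close>

lemma psd_on_shift:
  assumes K: "finite K" "real (card K) \<le> n" and n: "2 \<le> n"
    and X: "\<And>i. i \<in> K \<Longrightarrow> 0 \<le> X i i" "\<And>i j. i \<in> K \<Longrightarrow> j \<in> K \<Longrightarrow> X i j = X j i"
      "\<And>i j. i \<in> K \<Longrightarrow> j \<in> K \<Longrightarrow> (X i j)\<^sup>2 \<le> X i i * X j j"
    and tr: "(\<Sum>i\<in>K. X i i) \<le> 1"
  shows "psd_on K (\<lambda>i j. X i j + (1 - 2 / n) * (if i = j then 1 else 0))"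
  unfolding psd_on_quad
proof (intro conjI ballI allI)
  let ?A = "\<lambda>i j. X i j + (1 - 2 / n) * (if i = j then 1 else 0)"
  show "?A i j = ?A j i" if "i \<in> K" "j \<in> K" for i j
    using X(2)[OF that] by simp
  fix v :: "'a \<Rightarrow> real"
  define q where "q i = sqrt (X i i)" for i
  have q: "(q i)\<^sup>2 = X i i" if "i \<in> K" for i
    using X(1)[OF that] by (simp add: q_def)
  let ?D = "\<lambda>i. (2 * (q i)\<^sup>2 + (1 - 2 / n)) * (v i)\<^sup>2"
  have entry: "(if i = j then ?D i else 0) - (q i * \<bar>v i\<bar>) * (q j * \<bar>v j\<bar>) \<le> v i * ?A i j * v j"
    if ij: "i \<in> K" "j \<in> K" for i j
  proof (cases "i = j")
    case True
    have "v i * ?A i i * v i = ?D i - (q i)\<^sup>2 * (v i)\<^sup>2"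
      using q[OF ij(1)] by (simp add: algebra_simps power2_eq_square)
    moreover have "(q i * \<bar>v i\<bar>) * (q i * \<bar>v i\<bar>) = (q i)\<^sup>2 * (v i)\<^sup>2"
      by (metis power2_abs power2_eq_square power_mult_distrib)
    ultimately show ?thesis
      using True by simp
  next
    case False
    have "\<bar>X i j\<bar> \<le> q i * q j"
      unfolding q_def real_sqrt_mult[symmetric]
      using X(3)[OF ij] by (metis real_sqrt_abs real_sqrt_le_iff)
    then have "\<bar>v i * X i j * v j\<bar> \<le> (q i * \<bar>v i\<bar>) * (q j * \<bar>v j\<bar>)"
      using mult_right_mono[of "\<bar>X i j\<bar>" "q i * q j" "\<bar>v i\<bar> * \<bar>v j\<bar>"]
      by (simp add: abs_mult mult_ac)
    then show ?thesis
      using False by simp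
  qed
  have "(\<Sum>i\<in>K. \<Sum>j\<in>K. (if i = j then ?D i else 0)) = (\<Sum>i\<in>K. ?D i)"
    using K by simp
  moreover have "(\<Sum>i\<in>K. \<Sum>j\<in>K. (q i * \<bar>v i\<bar>) * (q j * \<bar>v j\<bar>)) = (\<Sum>i\<in>K. q i * \<bar>v i\<bar>)\<^sup>2"
    by (simp add: power2_eq_square sum_product)
  moreover have "(\<Sum>i\<in>K. \<Sum>j\<in>K. (if i = j then ?D i else 0) - (q i * \<bar>v i\<bar>) * (q j * \<bar>v j\<bar>))
      \<le> quad K ?A v"
    unfolding quad_def by (intro sum_mono entry)
  ultimately have "(\<Sum>i\<in>K. ?D i) - (\<Sum>i\<in>K. q i * \<bar>v i\<bar>)\<^sup>2 \<le> quad K ?A v"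
    by (simp add: sum_subtractf)
  moreover have "(\<Sum>i\<in>K. q i * \<bar>v i\<bar>)\<^sup>2 \<le> (\<Sum>i\<in>K. ?D i)"
  proof -
    have "(\<Sum>i\<in>K. (q i)\<^sup>2) \<le> 1"
      using tr q by (simp cong: sum.cong)
    from weighted_square_sum_bound[OF K n this, of "\<lambda>i. \<bar>v i\<bar>"] show ?thesis
      by simp
  qed
  ultimately show "0 \<le> quad K ?A v"
    by linarith
qed

subsection \<open>Chordal graphs\<close>

text \<open>A repeated vertex or a chord would give a shortcut in a walk of least length, so such a
  walk is an induced path. Chords are stated forward only, the relation being symmetric where this
  is applied.\<close>

lemma shortest_walk:
  assumes "(s, t) \<in> R\<^sup>*"
  obtains n f where "f 0 = s" "f n = t" "\<And>i. i < n \<Longrightarrow> (f i, f (Suc i)) \<in> R"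
    "\<And>i j. i < j \<Longrightarrow> j \<le> n \<Longrightarrow> f i \<noteq> f j"
    "\<And>i j. i < j \<Longrightarrow> j \<le> n \<Longrightarrow> (f i, f j) \<in> R \<Longrightarrow> j = Suc i"
proof -
  define n where "n = (LEAST n. (s, t) \<in> R ^^ n)"
  have "(s, t) \<in> R ^^ n"
    unfolding n_def using assms rtrancl_imp_relpow by (metis LeastI)
  then obtain f where f: "f 0 = s" "f n = t" "\<And>i. i < n \<Longrightarrow> (f i, f (Suc i)) \<in> R"
    unfolding relpow_fun_conv by blast
  have minimal: "n \<le> m" if "(s, t) \<in> R ^^ m" for m
    unfolding n_def using that by (rule Least_le)
  have seg: "(f i, f j) \<in> R ^^ (j - i)" if "i \<le> j" "j \<le> n" for i j
    unfolding relpow_fun_conv using that f(3)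
    by (intro exI[of _ "\<lambda>k. f (i + k)"]) auto
  show ?thesis
  proof (rule that[OF f])
    fix i j assume ij: "i < j" "j \<le> n"
    have pre: "(s, f i) \<in> R ^^ i" and post: "(f j, t) \<in> R ^^ (n - j)"
      using seg[of 0 i] seg[of j n] ij f by auto
    show "f i \<noteq> f j"
    proof
      assume "f i = f j"
      then have "(s, t) \<in> R ^^ (i + (n - j))"
        using pre post by (auto simp: relpow_add)
      then show False
        using minimal[of "i + (n - j)"] ij by simp
    qed
    show "j = Suc i" if "(f i, f j) \<in> R"
    proof -
      have "(s, f j) \<in> R ^^ Suc i"
        using pre that by auto
      then have "(s, t) \<in> R ^^ (Suc i + (n - j))"
        using post by (metis relcompI relpow_add)
      then show ?thesis
        using minimal[of "Suc i + (n - j)"] ij by simp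
    qed
  qed
qed

text \<open>For \<open>i < j\<close> the cyclic condition has a single wrap-around case, first
  against last vertex, so the modular arithmetic is dealt with here once.\<close>

lemma induced_cycleI:
  assumes "3 \<le> length c" "distinct c" "set c \<subseteq> V"
    and adj: "\<And>i j. i < j \<Longrightarrow> j < length c \<Longrightarrow>
      {c ! i, c ! j} \<in> E \<longleftrightarrow> j = Suc i \<or> i = 0 \<and> Suc j = length c"
  shows "induced_cycle V E c"
  unfolding induced_cycle_def
proof (intro conjI allI impI assms(1-3))
  fix i j assume ij: "i < length c" "j < length c" "i \<noteq> j"
  have mod: "Suc k mod length c = (if Suc k = length c then 0 else Suc k)" if "k < length c" for k
    using that by (auto simp: mod_less)
  show "{c ! i, c ! j} \<in> E \<longleftrightarrow> j = Suc i mod length c \<or> i = Suc j mod length c"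
  proof (cases "i < j")
    case True
    then show ?thesis
      using adj[of i j] ij assms(1) by (auto simp: mod)
  next
    case False
    then show ?thesis
      using adj[of j i] ij assms(1) by (auto simp: mod insert_commute)
  qed
qed

section \<open>Simplicial vertices and Dirac's theorem\<close>

definition simplicial :: "'a set \<Rightarrow> 'a set set \<Rightarrow> 'a \<Rightarrow> bool" where
  "simplicial W F x \<longleftrightarrow> clique {y \<in> W. y \<noteq> x \<and> {x, y} \<in> F} F"

text \<open>Only edges inside the vertex set matter for an induced cycle, so \<open>U\<close> with
  the unrestricted \<open>F\<close> stands for the induced subgraph.\<close>

lemma chordal_subset: "chordal W F \<Longrightarrow> U \<subseteq> W \<Longrightarrow> chordal U F"
  unfolding chordal_def induced_cycle_def by (meson order_trans)

text \<open>The vertex \<open>v\<close> is adjacent to \<open>s\<close> and \<open>t\<close> but to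
  nothing in \<open>C\<close>. A shortest walk from \<open>s\<close> to \<open>t\<close> through
  \<open>C\<close> would close up at \<open>v\<close> to an induced cycle, of length at least 4
  because \<open>s\<close> and \<open>t\<close> are not adjacent.\<close>

lemma chordal_no_detour:
  assumes "chordal W F" and v: "v \<in> W" "{v, s} \<in> F" "{v, t} \<in> F"
    and st: "s \<noteq> t" "{s, t} \<notin> F" "s \<in> W" "t \<in> W"
    and C: "C \<subseteq> W" "v \<notin> C" "\<And>c. c \<in> C \<Longrightarrow> {v, c} \<notin> F" "v \<noteq> s" "v \<noteq> t"
  shows "(s, t) \<notin> {(a, b). a \<in> insert s (insert t C) \<and> b \<in> insert s (insert t C) \<and> {a, b} \<in> F}\<^sup>*"
    (is "_ \<notin> ?R\<^sup>*")
proof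
  assume "(s, t) \<in> ?R\<^sup>*"
  then obtain n f where f: "f 0 = s" "f n = t" "\<And>i. i < n \<Longrightarrow> (f i, f (Suc i)) \<in> ?R"
    and neq: "\<And>i j. i < j \<Longrightarrow> j \<le> n \<Longrightarrow> f i \<noteq> f j"
    and chord: "\<And>i j. i < j \<Longrightarrow> j \<le> n \<Longrightarrow> (f i, f j) \<in> ?R \<Longrightarrow> j = Suc i"
    by (rule shortest_walk) blast
  have mem: "f i \<in> insert s (insert t C)" if "i \<le> n" for i
    using that f(1,2) f(3)[of i] by (cases "i = n") auto
  have "n \<noteq> 0"
    using f st by metis
  moreover have "n \<noteq> 1"
    using f(1,2) f(3)[of 0] st by auto
  ultimately have n: "2 \<le> n"
    by simp
  have adj_v: "{v, f i} \<in> F \<longleftrightarrow> i = 0 \<or> i = n" if "i \<le> n" for i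
  proof (cases "i = 0 \<or> i = n")
    case False
    then have "f i \<noteq> s" "f i \<noteq> t"
      using neq[of 0 i] neq[of i n] f that by auto
    then show ?thesis
      using mem[OF that] C False by auto
  qed (use f v in auto)
  have adj_f: "{f i, f j} \<in> F \<longleftrightarrow> j = Suc i" if "i < j" "j \<le> n" for i j
    using that mem[of i] mem[of j] chord[of i j] f(3)[of i] by auto
  \<comment> \<open>Putting \<open>v\<close> first shifts the walk by one position; the walk itself
    has \<open>n + 1\<close> vertices.\<close>
  define c where "c = v # map f [0..<Suc n]"
  have len: "length c = n + 2"
    by (simp add: c_def)
  have nth: "c ! Suc i = f i" if "i \<le> n" for i
    using that by (simp add: c_def del: upt_Suc)
  have "inj_on f {0..<Suc n}"
    by (rule linorder_inj_onI) (auto simp: neq)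
  moreover have "v \<noteq> f i" if "i \<le> n" for i
    using mem[OF that] C by auto
  then have "v \<notin> f ` {0..<Suc n}"
    by (metis atLeastLessThan_iff imageE less_Suc_eq_le)
  ultimately have dist: "distinct c"
    by (simp add: c_def distinct_map del: upt_Suc)
  have "f i \<in> W" if "i \<le> n" for i
    using mem[OF that] C st by auto
  then have sub: "set c \<subseteq> W"
    using v by (auto simp: c_def simp del: upt_Suc)
  have "induced_cycle W F c"
  proof (rule induced_cycleI[OF _ dist sub])
    show "3 \<le> length c"
      using len n by simp
    fix i j assume ij: "i < j" "j < length c"
    then obtain k where k: "j = Suc k" "k \<le> n"
      using len by (cases j) auto
    show "{c ! i, c ! j} \<in> F \<longleftrightarrow> j = Suc i \<or> i = 0 \<and> Suc j = length c"
    proof (cases i)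
      case 0
      then show ?thesis
        using k nth adj_v[of k] len by (simp add: c_def[THEN arg_cong[of _ _ "\<lambda>c. c ! 0"]])
    next
      case (Suc l)
      then show ?thesis
        using k ij nth adj_f[of l k] by simp
    qed
  qed
  then show False
    using assms(1) len n unfolding chordal_def by auto
qed

text \<open>
  Dirac's theorem. The neighbours of a connected component \<open>C\<close> of the non-neighbours of \<open>v\<close> form
  a clique \<open>S\<close>, and the induction hypothesis is applied to the smaller graph induced by \<open>C \<union> S\<close>.
\<close>
lemma chordal_simplicial_nonadjacent:
  assumes "finite W" "chordal W F" "v \<in> W" "u \<in> W" "u \<noteq> v" "{u, v} \<notin> F"
  shows "\<exists>x\<in>W. x \<noteq> v \<and> {x, v} \<notin> F \<and> simplicial W F x"
  using assms
proof (induction W arbitrary: v u rule: finite_psubset_induct)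
  case (psubset W)
  define B where "B = {y \<in> W. y \<noteq> v \<and> {y, v} \<notin> F}"
  define R where "R = {(a, b). a \<in> B \<and> b \<in> B \<and> {a, b} \<in> F}"
  define C where "C = {y. (u, y) \<in> R\<^sup>*}"
  define S where "S = {s \<in> W - C. \<exists>c\<in>C. {s, c} \<in> F}"
  have u: "u \<in> B" "u \<in> C"
    using psubset.prems by (auto simp: B_def C_def)
  have C_B: "C \<subseteq> B"
  proof
    fix y assume "y \<in> C"
    then have "(u, y) \<in> R\<^sup>*"
      by (simp add: C_def)
    then show "y \<in> B"
      by (induction rule: rtrancl_induct) (auto simp: R_def u)
  qed
  have C_step: "b \<in> C" if "a \<in> C" "b \<in> B" "{a, b} \<in> F" for a b
    using that C_B unfolding C_def R_def by (auto intro: rtrancl_into_rtrancl)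
  \<comment> \<open>A vertex of \<open>S\<close> that were a non-neighbour of \<open>v\<close> would
    already belong to the component \<open>C\<close>.\<close>
  have S_v: "s \<noteq> v \<and> {s, v} \<in> F" if s: "s \<in> S" for s
  proof -
    obtain c where c: "c \<in> C" "{s, c} \<in> F" "s \<in> W" "s \<notin> C"
      using s by (auto simp: S_def)
    then have "s \<notin> B"
      using C_step[of c s] by (auto simp: insert_commute)
    moreover have "s \<noteq> v"
      using c C_B by (auto simp: B_def insert_commute)
    ultimately show ?thesis
      using c by (auto simp: B_def)
  qed
  have S_clique: "clique S F"
    unfolding clique_def
  proof (intro ballI impI)
    fix s t assume st: "s \<in> S" "t \<in> S" "s \<noteq> t"
    let ?R = "{(a, b). a \<in> insert s (insert t C) \<and> b \<in> insert s (insert t C) \<and> {a, b} \<in> F}"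
    show "{s, t} \<in> F"
    proof (rule ccontr)
      assume "{s, t} \<notin> F"
      then have "(s, t) \<notin> ?R\<^sup>*"
        using st S_v C_B psubset.prems
        by (intro chordal_no_detour[of W F v s t C])
          (auto simp: S_def B_def insert_commute)
      moreover obtain a b where ab: "a \<in> C" "{s, a} \<in> F" "b \<in> C" "{t, b} \<in> F"
        using st by (auto simp: S_def)
      have "sym ?R"
        by (auto simp: sym_def insert_commute)
      then have sym: "sym (?R\<^sup>*)"
        by (rule sym_rtrancl)
      \<comment> \<open>Since \<open>C\<close> is connected, \<open>s\<close>, \<open>a\<close>,
        ..., \<open>u\<close>, ..., \<open>b\<close>, \<open>t\<close> is a walk through
        \<open>C\<close>: the forbidden detour.\<close>
      have reach: "(u, y) \<in> ?R\<^sup>*" if "y \<in> C" for y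
      proof -
        have "(u, y) \<in> R\<^sup>*"
          using that by (simp add: C_def)
        then show ?thesis
        proof (induction rule: rtrancl_induct)
          case (step y z)
          then have "y \<in> C" "z \<in> C"
            by (auto simp: C_def intro: rtrancl_into_rtrancl)
          then have "(y, z) \<in> ?R"
            using step.hyps by (auto simp: R_def)
          then show ?case
            using step.IH by (rule rtrancl_into_rtrancl[rotated])
        qed simp
      qed
      have "(s, a) \<in> ?R" "(b, t) \<in> ?R"
        using ab by (auto simp: insert_commute)
      moreover have "(a, u) \<in> ?R\<^sup>*" "(u, b) \<in> ?R\<^sup>*"
        using reach ab sym by (auto dest: symD)
      ultimately show False
        by (meson converse_rtrancl_into_rtrancl rtrancl_into_rtrancl rtrancl_trans)
    qed
  qed
  define W' where "W' = C \<union> S"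
  have v_notin: "v \<notin> W'"
    using C_B S_v by (auto simp: W'_def B_def)
  have W'_W: "W' \<subset> W"
    using C_B v_notin psubset.prems by (auto simp: W'_def B_def S_def)
  have chordal': "chordal W' F"
    using psubset.prems W'_W by (auto intro: chordal_subset)
  have "\<exists>x\<in>C. simplicial W' F x"
  proof (cases "\<exists>a\<in>W'. \<exists>b\<in>W'. a \<noteq> b \<and> {a, b} \<notin> F")
    case False
    then show ?thesis
      using u by (auto simp: simplicial_def clique_def)
  next
    case True
    \<comment> \<open>The induction hypothesis gives a simplicial vertex not adjacent to
      \<open>b\<close>; if \<open>b\<close> equals or is adjacent to every vertex of
      \<open>S\<close>, that vertex lies in \<open>C\<close>. Such a \<open>b\<close> is found in
      the clique \<open>S\<close> if some vertex of \<open>S\<close> has a non-neighbour; otherwise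
      any non-adjacent pair will do.\<close>
    have "\<exists>b\<in>W'. \<exists>a\<in>W'. a \<noteq> b \<and> {a, b} \<notin> F \<and> (\<forall>s\<in>S. s = b \<or> {s, b} \<in> F)"
    proof (cases "\<exists>s\<in>S. \<exists>a\<in>W'. a \<noteq> s \<and> {a, s} \<notin> F")
      case True
      then show ?thesis
        using S_clique by (fastforce simp: clique_def W'_def)
    next
      case no: False
      then have "\<forall>s\<in>S. s = b \<or> {s, b} \<in> F" if "b \<in> W'" for b
        using that by (auto simp: insert_commute)
      then show ?thesis
        using True by blast
    qed
    then obtain a b where ab: "b \<in> W'" "a \<in> W'" "a \<noteq> b" "{a, b} \<notin> F"
      and S_b: "\<forall>s\<in>S. s = b \<or> {s, b} \<in> F"
      by blast
    obtain x where "x \<in> W'" "x \<noteq> b" "{x, b} \<notin> F" "simplicial W' F x"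
      using psubset.IH[OF W'_W chordal' ab] by blast
    then show ?thesis
      using S_b by (auto simp: W'_def)
  qed
  then obtain x where x: "x \<in> C" "simplicial W' F x"
    by blast
  \<comment> \<open>Edges leave \<open>C\<close> only towards \<open>S\<close>, so \<open>x\<close>
    has the same neighbours in \<open>W\<close> as in \<open>W'\<close>.\<close>
  have "{y \<in> W. y \<noteq> x \<and> {x, y} \<in> F} = {y \<in> W'. y \<noteq> x \<and> {x, y} \<in> F}"
    using x W'_W by (auto simp: W'_def S_def insert_commute)
  then have "simplicial W F x"
    using x by (simp add: simplicial_def)
  then show ?case
    using x C_B by (auto simp: B_def)
qed

lemma chordal_simplicial:
  assumes "finite W" "chordal W F" "W \<noteq> {}"
  shows "\<exists>x\<in>W. simplicial W F x"
proof (cases "clique W F")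
  case True
  then show ?thesis
    using assms(3) by (auto simp: simplicial_def clique_def)
next
  case False
  then obtain u v where "u \<in> W" "v \<in> W" "u \<noteq> v" "{u, v} \<notin> F"
    by (auto simp: clique_def)
  then show ?thesis
    using chordal_simplicial_nonadjacent[OF assms(1,2)] by blast
qed

section \<open>PSD completion over chordal graphs\<close>

text \<open>A simplicial vertex \<open>u\<close> forms a clique with its neighbourhood
  \<open>N\<close>, so the prescribed block there is PSD and overlaps the completed rest exactly in
  \<open>N\<close>. The case \<open>i = j\<close> is listed apart since \<open>F\<close> may lack
  loops here.\<close>

lemma chordal_psd_completion:
  assumes "finite W" "chordal W F"
    and "\<And>K. K \<subseteq> W \<Longrightarrow> clique K F \<Longrightarrow> psd_on K X"
  shows "\<exists>Y. psd_on W Y \<and> (\<forall>i\<in>W. \<forall>j\<in>W. i = j \<or> {i, j} \<in> F \<longrightarrow> Y i j = X i j)"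
  using assms
proof (induction W rule: finite_psubset_induct)
  case (psubset W)
  show ?case
  proof (cases "W = {}")
    case True
    then show ?thesis
      by (simp add: psd_on_def)
  next
    case False
    then obtain u where u: "u \<in> W" "simplicial W F u"
      using chordal_simplicial psubset by metis
    define K where "K = W - {u}"
    define N where "N = {y \<in> W. y \<noteq> u \<and> {u, y} \<in> F}"
    have K: "finite K" "u \<notin> K" "N \<subseteq> K" "W = insert u K" "K \<subset> W"
      using psubset u by (auto simp: K_def N_def)
    have "chordal K F"
      using chordal_subset psubset.prems(1) K by blast
    then obtain Y where Y: "psd_on K Y"
      and Y_eq: "\<And>i j. i \<in> K \<Longrightarrow> j \<in> K \<Longrightarrow> i = j \<or> {i, j} \<in> F \<Longrightarrow> Y i j = X i j"
      using psubset.IH[OF \<open>K \<subset> W\<close>] psubset.prems(2) K by (metis order_trans psubset_imp_subset)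
    have N_clique: "clique N F"
      using u by (simp add: simplicial_def N_def)
    then have "clique (insert u N) F"
      by (auto simp: clique_def N_def insert_commute)
    then have "psd_on (insert u N) X"
      using u by (intro psubset.prems(2)) (auto simp: N_def)
    then obtain Z where Z: "psd_on (insert u K) Z"
      "\<And>i j. i \<in> K \<Longrightarrow> j \<in> K \<Longrightarrow> Z i j = Y i j"
      "\<And>i. i \<in> insert u N \<Longrightarrow> Z i u = X i u \<and> Z u i = X u i"
    proof (rule psd_on_add_vertex[OF K(1-3) Y])
      show "Y i j = X i j" if "i \<in> N" "j \<in> N" for i j
        using that N_clique K(3) by (intro Y_eq) (auto simp: clique_def)
    qed blast
    have "Z i j = X i j" if "i \<in> W" "j \<in> W" "i = j \<or> {i, j} \<in> F" for i j
    proof (cases "i \<in> K \<and> j \<in> K")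
      case True
      then show ?thesis
        using Z(2) Y_eq that by simp
    next
      case False
      then have "i = u \<and> j \<in> insert u N \<or> j = u \<and> i \<in> insert u N"
        using that by (auto simp: K_def N_def insert_commute)
      then show ?thesis
        using Z(3) by auto
    qed
    then show ?thesis
      using Z(1) K(4) by blast
  qed
qed

section \<open>Clique number and treewidth\<close>

lemma graph_edgeD:
  assumes "graph V E" "{i, j} \<in> E"
  shows "i \<in> V" "j \<in> V"
  using assms unfolding graph_def by (metis doubleton_eq_iff)+

lemma graph_loop: "graph V E \<Longrightarrow> i \<in> V \<Longrightarrow> {i} \<in> E"
  by (auto simp: graph_def)

lemma clique_number_ge:
  assumes "finite V" "K \<subseteq> V" "clique K E"
  shows "card K \<le> clique_number V E"
  unfolding clique_number_def using assms by (intro Max_ge) auto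

lemma clique_number_attained:
  assumes "finite V"
  obtains K where "K \<subseteq> V" "clique K E" "card K = clique_number V E"
proof -
  have "{} \<in> {K. K \<subseteq> V \<and> clique K E}"
    by simp
  then have "clique_number V E \<in> card ` {K. K \<subseteq> V \<and> clique K E}"
    unfolding clique_number_def using assms by (intro Max_in) auto
  then show ?thesis
    using that by auto
qed

lemma clique_number_pos:
  assumes "finite V" "V \<noteq> {}"
  shows "1 \<le> clique_number V E"
proof -
  obtain x where "x \<in> V"
    using assms by blast
  then show ?thesis
    using clique_number_ge[of V "{x}" E] assms by (simp add: clique_def)
qed

text \<open>Positions 0 and 2 of a cycle with at least 4 vertices are never consecutive, yet
  adjacent here. This makes the set minimised in the treewidth nonempty.\<close>

lemma complete_graph_chordal: "chordal V {{i, j} |i j. i \<in> V \<and> j \<in> V}"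
  unfolding chordal_def
proof
  assume "\<exists>c. induced_cycle V {{i, j} |i j. i \<in> V \<and> j \<in> V} c \<and> 4 \<le> length c"
  then obtain c where c: "induced_cycle V {{i, j} |i j. i \<in> V \<and> j \<in> V} c" "4 \<le> length c"
    by blast
  then have "set c \<subseteq> V" "0 < length c" "2 < length c"
    by (auto simp: induced_cycle_def)
  then have "c ! 0 \<in> V" "c ! 2 \<in> V"
    by (meson nth_mem subsetD)+
  then have "{c ! 0, c ! 2} \<in> {{i, j} |i j. i \<in> V \<and> j \<in> V}"
    by blast
  moreover have "0 < length c" "2 < length c" "(0::nat) \<noteq> 2"
    using c by auto
  ultimately have "2 = Suc 0 mod length c \<or> 0 = Suc 2 mod length c"
    using c unfolding induced_cycle_def by blast
  then show False
    using c by simp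
qed

lemma treewidth_attained:
  assumes "graph V E"
  obtains W F where "graph W F" "chordal W F" "subgraph V E W F"
    "clique_number W F = treewidth V E"
proof -
  let ?F = "{{i, j} |i j. i \<in> V \<and> j \<in> V}"
  have "graph V ?F"
    using assms by (auto simp: graph_def)
  moreover have "subgraph V E V ?F"
    using assms unfolding subgraph_def graph_def by blast
  ultimately have "\<exists>k W F. graph W F \<and> chordal W F \<and> subgraph V E W F \<and> clique_number W F = k"
    using complete_graph_chordal by blast
  then have "\<exists>W F. graph W F \<and> chordal W F \<and> subgraph V E W F \<and>
      clique_number W F = treewidth V E"
    unfolding treewidth_def by (rule LeastI_ex)
  then show ?thesis
    using that by blast
qed

section \<open>Partial matrices and their shifts\<close>

lemma partial_sym_diag_outside:
  assumes "graph V E" "X \<in> partial_sym E" "i \<notin> V"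
  shows "X i i = 0"
proof -
  have "{i, i} \<notin> E"
    using graph_edgeD[OF assms(1)] assms(3) by blast
  then show ?thesis
    using assms(2) unfolding partial_sym_def by blast
qed

lemma edgewise_psd_diag_nonneg:
  assumes "X \<in> edgewise_psd E"
  shows "0 \<le> X i i"
proof (cases "{i, i} \<in> E")
  case True
  then have "psd_on {i, i} X"
    using assms unfolding edgewise_psd_def by blast
  then show ?thesis
    by (rule psd_on_diag_nonneg) auto
next
  case False
  then have "X i i = 0"
    using assms unfolding edgewise_psd_def partial_sym_def by blast
  then show ?thesis
    by simp
qed

text \<open>Unspecified entries are represented by \<open>0\<close>, so the bound also holds at the
  edges that a supergraph adds.\<close>

lemma edgewise_psd_entry_bound:
  assumes "X \<in> edgewise_psd E"
  shows "(X i j)\<^sup>2 \<le> X i i * X j j"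
proof (cases "{i, j} \<in> E")
  case True
  then have "psd_on {i, j} X"
    using assms by (simp add: edgewise_psd_def)
  then show ?thesis
    by (rule psd_on_entry_bound) auto
next
  case False
  then have "X i j = 0"
    using assms by (simp add: edgewise_psd_def partial_sym_def)
  then show ?thesis
    using edgewise_psd_diag_nonneg[OF assms] by simp
qed

lemma shift_completable_iff:
  assumes "graph V E" "X \<in> partial_sym E"
  shows "(\<lambda>i j. X i j + e * partial_id E i j) \<in> psd_completable V E \<longleftrightarrow>
    (\<exists>Y. psd_on V Y \<and> (\<forall>i j. {i, j} \<in> E \<longrightarrow> Y i j = X i j + e * (if i = j then 1 else 0)))"
proof -
  have "(\<lambda>i j. X i j + e * partial_id E i j) \<in> partial_sym E"
    using assms(2) by (auto simp: partial_sym_def partial_id_def partial_proj_def insert_commute)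
  then show ?thesis
    by (auto simp: psd_completable_def partial_id_def partial_proj_def)
qed

lemma chordal_cover_completable:
  assumes G: "graph V E" "V \<noteq> {}" and H: "graph W F" "chordal W F" "subgraph V E W F"
    and X: "X \<in> edgewise_psd E" "partial_trace V X = 1"
  shows "(\<lambda>i j. X i j + (1 - 2 / (real (clique_number W F) + 1)) * partial_id E i j)
    \<in> psd_completable V E"
proof -
  define n where "n = real (clique_number W F) + 1"
  let ?A = "\<lambda>i j. X i j + (1 - 2 / n) * (if i = j then 1 else 0)"
  have W: "finite W" "V \<subseteq> W" "E \<subseteq> F" "W \<noteq> {}"
    using G H by (auto simp: graph_def subgraph_def)
  have sym: "X \<in> partial_sym E"
    using X by (simp add: edgewise_psd_def)
  have "psd_on K ?A" if K: "K \<subseteq> W" "clique K F" for K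
  proof (rule psd_on_shift)
    show "finite K"
      using K W finite_subset by blast
    show "real (card K) \<le> n"
      using clique_number_ge[OF W(1) K] by (simp add: n_def)
    show "2 \<le> n"
      using clique_number_pos[OF W(1,4), of F] by (simp add: n_def)
    show "X i j = X j i" for i j
      using sym by (simp add: partial_sym_def)
    \<comment> \<open>Vertices added by the supergraph have zero diagonal entry, so the trace over
      \<open>W\<close> is still 1 and every clique sum is at most 1.\<close>
    have "X i i = 0" if "i \<notin> V" for i
      by (rule partial_sym_diag_outside[OF G(1) sym that])
    then have "(\<Sum>i\<in>W. X i i) = 1"
      using sum.mono_neutral_right[OF W(1,2), of "\<lambda>i. X i i"] X(2)
      by (auto simp: partial_trace_def)
    moreover have "(\<Sum>i\<in>K. X i i) \<le> (\<Sum>i\<in>W. X i i)"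
      using K W edgewise_psd_diag_nonneg[OF X(1)] by (intro sum_mono2) auto
    ultimately show "(\<Sum>i\<in>K. X i i) \<le> 1"
      by simp
  qed (use edgewise_psd_diag_nonneg[OF X(1)] edgewise_psd_entry_bound[OF X(1)] in auto)
  then obtain Y where Y: "psd_on W Y"
    "\<And>i j. i \<in> W \<Longrightarrow> j \<in> W \<Longrightarrow> i = j \<or> {i, j} \<in> F \<Longrightarrow> Y i j = ?A i j"
    using chordal_psd_completion[OF W(1) H(2), of ?A] by blast
  have "psd_on V Y"
    using psd_on_subset[OF Y(1) W(2,1)] .
  moreover have "Y i j = ?A i j" if "{i, j} \<in> E" for i j
    using that graph_edgeD[OF G(1) that] W Y(2) by blast
  ultimately show ?thesis
    using shift_completable_iff[OF G(1) sym] unfolding n_def by blast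
qed

subsection \<open>Attainment of the minimum and the maximum\<close>

text \<open>Tychonoff's theorem, translated from abstract product topologies to the topology of the
  function type.\<close>

lemma compact_Pi_UNIV:
  fixes S :: "'i \<Rightarrow> 'b::topological_space set"
  assumes "\<And>i. compact (S i)"
  shows "compact (Pi UNIV S)"
  using compactin_PiE[of "\<lambda>_. euclidean" UNIV S] assms
  by (simp add: euclidean_product_topology PiE_UNIV_domain)

lemma compact_bounded_matrices: "compact {Y :: 'a \<Rightarrow> 'b \<Rightarrow> real. \<forall>i j. \<bar>Y i j\<bar> \<le> c}"
proof -
  have "compact (Pi UNIV (\<lambda>_::'a. Pi UNIV (\<lambda>_::'b. {- c..c})))"
    by (intro compact_Pi_UNIV compact_Icc)
  also have "Pi UNIV (\<lambda>_::'a. Pi UNIV (\<lambda>_::'b. {- c..c})) = {Y. \<forall>i j. \<bar>Y i j\<bar> \<le> c}"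
    by (auto simp: Pi_def abs_le_iff minus_le_iff)
  finally show ?thesis .
qed

lemma continuous_on_entry [continuous_intros]:
  "continuous_on A (\<lambda>Y :: 'a \<Rightarrow> 'b \<Rightarrow> real. Y i j)"
proof -
  have "continuous_on UNIV (\<lambda>Y :: 'a \<Rightarrow> 'b \<Rightarrow> real. Y i j)"
    by (intro continuous_on_product_then_coordinatewise[OF continuous_on_product_coordinates])
  then show ?thesis
    by (rule continuous_on_subset) simp
qed

lemma closed_psd_on: "closed {Y. psd_on K Y}"
  unfolding psd_on_def Ball_def
  by (intro closed_Collect_conj closed_Collect_all closed_Collect_imp open_Collect_const
      closed_Collect_eq closed_Collect_le continuous_intros)

text \<open>The shift is recovered from a completion as \<open>Y k k - X k k\<close> at one vertex
  \<open>k\<close>, so minimising it means minimising a continuous coordinate on a compact set of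
  completions. The feasible \<open>e0\<close> bounds the diagonal, hence all entries over
  \<open>V\<close>, for shifts up to \<open>e0\<close>.\<close>

lemma psd_defect_attained:
  assumes G: "graph V E" "V \<noteq> {}" and X: "X \<in> partial_sym E"
    and e0: "(\<lambda>i j. X i j + e0 * partial_id E i j) \<in> psd_completable V E"
  shows "(\<lambda>i j. X i j + psd_defect V E X * partial_id E i j) \<in> psd_completable V E"
    and "\<And>e. (\<lambda>i j. X i j + e * partial_id E i j) \<in> psd_completable V E \<Longrightarrow> psd_defect V E X \<le> e"
proof -
  let ?P = "\<lambda>e. (\<lambda>i j. X i j + e * partial_id E i j) \<in> psd_completable V E"
  have fin: "finite V"
    using G by (simp add: graph_def)
  obtain k where k: "k \<in> V"
    using G by blast
  define c where "c = (\<Sum>i\<in>V. \<bar>X i i\<bar>) + \<bar>e0\<bar>"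
  define T where "T = {Y. \<forall>i j. \<bar>Y i j\<bar> \<le> c} \<inter> ({Y. psd_on V Y} \<inter>
    {Y. \<forall>i j. {i, j} \<in> E \<longrightarrow> Y i j = X i j + (Y k k - X k k) * (if i = j then 1 else 0)})"
  have "compact T"
    unfolding T_def
    by (intro compact_Int_closed compact_bounded_matrices closed_Int closed_psd_on
        closed_Collect_all closed_Collect_imp open_Collect_const closed_Collect_eq
        continuous_intros)
  have into_T: "\<exists>Y\<in>T. Y k k = X k k + e" if e: "?P e" "e \<le> e0" for e
  proof -
    obtain Y where Y: "psd_on V Y"
      "\<And>i j. {i, j} \<in> E \<Longrightarrow> Y i j = X i j + e * (if i = j then 1 else 0)"
      using e shift_completable_iff[OF G(1) X] by blast
    \<comment> \<open>Entries outside \<open>V\<close> are unconstrained; setting them to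
      \<open>0\<close> gives the bound at all indices.\<close>
    define Z where "Z i j = (if i \<in> V \<and> j \<in> V then Y i j else 0)" for i j
    have Z_psd: "psd_on V Z"
      using Y(1) psd_on_cong[of V Z Y] by (simp add: Z_def)
    have Z_E: "Z i j = X i j + e * (if i = j then 1 else 0)" if "{i, j} \<in> E" for i j
      using Y(2)[OF that] graph_edgeD[OF G(1) that] by (simp add: Z_def)
    have Z_diag: "Z i i = X i i + e" if "i \<in> V" for i
      using Z_E[of i i] graph_loop[OF G(1) that] by simp
    have c0: "0 \<le> c"
      by (simp add: c_def sum_nonneg)
    have diag: "0 \<le> Z i i \<and> Z i i \<le> c" if i: "i \<in> V" for i
    proof -
      have "\<bar>X i i\<bar> \<le> (\<Sum>i\<in>V. \<bar>X i i\<bar>)"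
        using fin i by (intro member_le_sum) auto
      then show ?thesis
        using psd_on_diag_nonneg[OF Z_psd fin i] Z_diag[OF i] e(2) by (simp add: c_def)
    qed
    have "\<bar>Z i j\<bar> \<le> c" for i j
    proof (cases "i \<in> V \<and> j \<in> V")
      case True
      then have "(Z i j)\<^sup>2 \<le> Z i i * Z j j"
        using psd_on_entry_bound[OF Z_psd fin] by blast
      also have "\<dots> \<le> c * c"
        using diag True c0 by (intro mult_mono) auto
      finally show ?thesis
        by (metis c0 power2_eq_square abs_le_square_iff abs_of_nonneg)
    next
      case False
      then show ?thesis
        using c0 by (auto simp: Z_def)
    qed
    then have "Z \<in> T"
      using Z_psd Z_E Z_diag[OF k] by (simp add: T_def)
    then show ?thesis
      using Z_diag[OF k] by blast
  qed
  have "T \<noteq> {}"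
    using into_T[OF e0] by blast
  then obtain Y where Y: "Y \<in> T" "\<And>Z. Z \<in> T \<Longrightarrow> Y k k \<le> Z k k"
    using continuous_attains_inf[OF \<open>compact T\<close>, of "\<lambda>Y. Y k k"]
      continuous_on_entry[of T k k] by blast
  define m where "m = Y k k - X k k"
  have "?P m"
    using Y(1) shift_completable_iff[OF G(1) X, of m] unfolding T_def m_def by blast
  moreover have "m \<le> e" if "?P e" for e
  proof -
    \<comment> \<open>The set \<open>T\<close> is only known to contain completions for shifts up to
      \<open>e0\<close>; a larger \<open>e\<close> is handled through \<open>e0\<close>
      itself.\<close>
    have "m \<le> min e e0"
      using into_T[of "min e e0"] Y(2) that e0 by (fastforce simp: m_def min_def)
    then show ?thesis
      by simp
  qed
  moreover have "psd_defect V E X = m"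
    unfolding psd_defect_def using calculation by (intro Least_equality) auto
  ultimately show "?P (psd_defect V E X)" "\<And>e. ?P e \<Longrightarrow> psd_defect V E X \<le> e"
    by auto
qed

section \<open>Continuity of the defect and compactness of its domain\<close>

text \<open>An entrywise change of at most \<open>d\<close> lowers the form by at most
  \<open>d\<close> times the square of the sum of \<open>|v i|\<close>. By Cauchy-Schwarz the extra
  diagonal shift \<open>card V * d\<close> pays for this.\<close>

lemma shift_completable_perturb:
  assumes G: "graph V E" and X: "X \<in> partial_sym E" "X' \<in> partial_sym E"
    and e: "(\<lambda>i j. X i j + e * partial_id E i j) \<in> psd_completable V E"
    and d: "\<And>i j. i \<in> V \<Longrightarrow> j \<in> V \<Longrightarrow> \<bar>X' i j - X i j\<bar> \<le> d"
  shows "(\<lambda>i j. X' i j + (e + real (card V) * d) * partial_id E i j) \<in> psd_completable V E"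
proof -
  have fin: "finite V"
    using G by (simp add: graph_def)
  obtain Y where Y: "psd_on V Y"
    "\<And>i j. {i, j} \<in> E \<Longrightarrow> Y i j = X i j + e * (if i = j then 1 else 0)"
    using e shift_completable_iff[OF G X(1)] by blast
  let ?n = "real (card V)"
  let ?I = "\<lambda>i j. if i = j then 1 else 0 :: real"
  let ?Z = "\<lambda>i j. Y i j + (X' i j - X i j) + ?n * d * ?I i j"
  have "psd_on V ?Z"
    unfolding psd_on_quad
  proof (intro conjI ballI allI)
    fix i j assume "i \<in> V" "j \<in> V"
    then have "Y i j = Y j i" "X i j = X j i" "X' i j = X' j i"
      using psd_on_sym[OF Y(1)] X by (auto simp: partial_sym_def)
    then show "?Z i j = ?Z j i"
      by simp
  next
    fix v :: "'a \<Rightarrow> real"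
    have "- (d * (\<bar>v i\<bar> * \<bar>v j\<bar>)) \<le> v i * (X' i j - X i j) * v j" if "i \<in> V" "j \<in> V" for i j
    proof -
      have "\<bar>v i * (X' i j - X i j) * v j\<bar> = \<bar>X' i j - X i j\<bar> * (\<bar>v i\<bar> * \<bar>v j\<bar>)"
        by (simp add: abs_mult)
      also have "\<dots> \<le> d * (\<bar>v i\<bar> * \<bar>v j\<bar>)"
        by (intro mult_right_mono d that) auto
      finally show ?thesis
        by linarith
    qed
    then have "(\<Sum>i\<in>V. \<Sum>j\<in>V. - (d * (\<bar>v i\<bar> * \<bar>v j\<bar>))) \<le> quad V (\<lambda>i j. X' i j - X i j) v"
      unfolding quad_def by (intro sum_mono)
    moreover have "(\<Sum>i\<in>V. \<Sum>j\<in>V. - (d * (\<bar>v i\<bar> * \<bar>v j\<bar>))) = - (d * (\<Sum>i\<in>V. \<bar>v i\<bar>)\<^sup>2)"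
      unfolding power2_eq_square sum_product by (simp add: sum_negf sum_distrib_left)
    moreover have "d * (\<Sum>i\<in>V. \<bar>v i\<bar>)\<^sup>2 \<le> d * (?n * (\<Sum>i\<in>V. (v i)\<^sup>2))"
    \<comment> \<open>Nonnegativity of \<open>d\<close> comes from an actual entry, so the empty
      vertex set is split off.\<close>
    proof (cases "V = {}")
      case False
      then have "0 \<le> d"
        using d by (meson abs_ge_zero ex_in_conv order_trans)
      moreover have "(\<Sum>i\<in>V. \<bar>v i\<bar>)\<^sup>2 \<le> ?n * (\<Sum>i\<in>V. (v i)\<^sup>2)"
        using Cauchy_Schwarz_ineq_sum[of "\<lambda>_. 1" "\<lambda>i. \<bar>v i\<bar>" V] by simp
      ultimately show ?thesis
        by (rule mult_left_mono[rotated])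
    qed simp
    moreover have "quad V ?Z v = quad V Y v + quad V (\<lambda>i j. X' i j - X i j) v
        + ?n * d * (\<Sum>i\<in>V. (v i)\<^sup>2)"
    proof -
      have "quad V ?Z v = (\<Sum>i\<in>V. \<Sum>j\<in>V. v i * Y i j * v j + v i * (X' i j - X i j) * v j +
          (if i = j then ?n * d * (v i)\<^sup>2 else 0))"
        unfolding quad_def
        by (intro sum.cong refl) (auto simp: algebra_simps power2_eq_square)
      then show ?thesis
        using fin by (simp add: quad_def sum.distrib sum_distrib_left)
    qed
    ultimately show "0 \<le> quad V ?Z v"
      using psd_on_quad_nonneg[OF Y(1), of v] by (simp add: algebra_simps)
  qed
  moreover have "?Z i j = X' i j + (e + ?n * d) * ?I i j" if "{i, j} \<in> E" for i j
    using Y(2)[OF that] by (simp add: algebra_simps)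
  ultimately show ?thesis
    using shift_completable_iff[OF G X(2)] by blast
qed

text \<open>Trace 1 bounds the nonnegative diagonal by 1, and the two by two minors then bound every
  entry by 1; all conditions are closed in the product topology.\<close>

lemma edgewise_psd_trace_compact:
  assumes "graph V E"
  shows "compact {X \<in> edgewise_psd E. partial_trace V X = 1}" (is "compact ?C")
proof -
  have fin: "finite V"
    using assms by (simp add: graph_def)
  have closed: "closed ?C"
    unfolding edgewise_psd_def partial_sym_def partial_trace_def mem_Collect_eq
    by (intro closed_Collect_conj closed_Collect_all closed_Collect_imp open_Collect_const
        closed_Collect_eq closed_psd_on continuous_intros)
  have "\<bar>X i j\<bar> \<le> 1" if "X \<in> ?C" for X i j
  proof -
    have X: "X \<in> edgewise_psd E" "(\<Sum>i\<in>V. X i i) = 1"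
      using that by (auto simp: partial_trace_def)
    have diag: "X i i \<le> 1" for i
    proof (cases "i \<in> V")
      case True
      then have "X i i \<le> (\<Sum>i\<in>V. X i i)"
        using fin edgewise_psd_diag_nonneg[OF X(1)] by (intro member_le_sum) auto
      then show ?thesis
        using X(2) by simp
    next
      case False
      then have "X i i = 0"
        using X(1) partial_sym_diag_outside[OF assms] by (auto simp: edgewise_psd_def)
      then show ?thesis
        by simp
    qed
    have "(X i j)\<^sup>2 \<le> X i i * X j j"
      by (rule edgewise_psd_entry_bound[OF X(1)])
    also have "\<dots> \<le> 1 * 1"
      using diag edgewise_psd_diag_nonneg[OF X(1)] by (intro mult_mono) auto
    finally show ?thesis
      by (simp add: abs_square_le_1)
  qed
  then have "{X. \<forall>i j. \<bar>X i j\<bar> \<le> 1} \<inter> ?C = ?C"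
    by blast
  with compact_Int_closed[OF compact_bounded_matrices closed] show ?thesis
    by (rule back_subst[of compact])
qed

text \<open>The perturbation bound applied both ways is a Lipschitz estimate in the entries over
  \<open>V\<close>. These are finitely many, so a neighbourhood in the product topology controls
  them all at once.\<close>

lemma continuous_on_psd_defect:
  assumes G: "graph V E" "V \<noteq> {}" and C: "C \<subseteq> partial_sym E"
    and ex: "\<And>X. X \<in> C \<Longrightarrow> \<exists>e. (\<lambda>i j. X i j + e * partial_id E i j) \<in> psd_completable V E"
  shows "continuous_on C (psd_defect V E)"
proof -
  have fin: "finite V" and card: "0 < real (card V)"
    using G by (auto simp: graph_def card_gt_0_iff)
  have le: "psd_defect V E X' \<le> psd_defect V E X + real (card V) * d"
    if XX': "X \<in> C" "X' \<in> C" and d: "\<And>i j. i \<in> V \<Longrightarrow> j \<in> V \<Longrightarrow> \<bar>X' i j - X i j\<bar> \<le> d" for X X' d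
  proof -
    have X: "X \<in> partial_sym E" "X' \<in> partial_sym E"
      using XX' C by auto
    obtain e where "(\<lambda>i j. X i j + e * partial_id E i j) \<in> psd_completable V E"
      using ex[OF XX'(1)] by blast
    then have "(\<lambda>i j. X' i j + (psd_defect V E X + real (card V) * d) * partial_id E i j)
        \<in> psd_completable V E"
      using shift_completable_perturb[OF G(1) X psd_defect_attained(1)[OF G X(1)] d] by blast
    then show ?thesis
      using psd_defect_attained(2)[OF G X(2)] by blast
  qed
  show ?thesis
    unfolding continuous_on_def
  proof (intro ballI tendstoI)
    fix X and e :: real assume X: "X \<in> C" and e: "0 < e"
    define d where "d = e / (2 * real (card V))"
    have d: "0 < d" "real (card V) * d < e"
      using e card by (auto simp: d_def field_simps)
    have "\<forall>\<^sub>F X' in at X within C. dist (X' i j) (X i j) < d" for i j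
    proof -
      have "((\<lambda>X'. X' i j) \<longlongrightarrow> X i j) (at X within C)"
        using continuous_on_entry[of C i j] X unfolding continuous_on_def by blast
      then show ?thesis
        using d(1) by (rule tendstoD)
    qed
    then have "\<forall>\<^sub>F X' in at X within C. \<forall>i\<in>V. \<forall>j\<in>V. dist (X' i j) (X i j) < d"
      using fin by (intro eventually_ball_finite ballI)
    moreover have "\<forall>\<^sub>F X' in at X within C. X' \<in> C"
      by (simp add: eventually_at_filter)
    ultimately show "\<forall>\<^sub>F X' in at X within C. dist (psd_defect V E X') (psd_defect V E X) < e"
    proof eventually_elim
      case (elim X')
      then have near: "\<bar>X' i j - X i j\<bar> \<le> d" "\<bar>X i j - X' i j\<bar> \<le> d" if "i \<in> V" "j \<in> V" for i j
        using that by (auto simp: dist_real_def abs_minus_commute less_imp_le)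
      show ?case
        using le[OF X elim(2) near(1)] le[OF elim(2) X near(2)] d(2) by (auto simp: dist_real_def)
    qed
  qed
qed

subsection \<open>The bounds\<close>

lemma clique_witness:
  assumes G: "graph V E" and K: "K \<subseteq> V" "clique K E" "K \<noteq> {}"
  obtains X where "X \<in> edgewise_psd E" "partial_trace V X = 1"
    "\<And>e. (\<lambda>i j. X i j + e * partial_id E i j) \<in> psd_completable V E \<Longrightarrow> 1 - 2 / real (card K) \<le> e"
proof -
  have fin: "finite V" "finite K"
    using G K finite_subset by (auto simp: graph_def)
  define n where "n = real (card K)"
  have n: "0 < n"
    using K fin by (simp add: n_def card_gt_0_iff)
  \<comment> \<open>On two distinct clique vertices the block is \<open>1 / n\<close> times the form
    \<open>(v i - v j)^2\<close>, hence PSD, while the sum of all entries over a large clique is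
    negative.\<close>
  define X where "X i j = (if i \<in> K \<and> j \<in> K then if i = j then 1 / n else - (1 / n) else 0)" for i j
  have K_E: "{i, j} \<in> E" if "i \<in> K" "j \<in> K" for i j
    using that K graph_loop[OF G] by (cases "i = j") (auto simp: clique_def)
  have sym: "X \<in> partial_sym E"
    using K_E by (auto simp: partial_sym_def X_def)
  have "psd_on {i, j} X" for i j
    unfolding psd_on_quad
  proof (intro conjI ballI allI)
    show "X a b = X b a" for a b
      by (simp add: X_def)
    fix v :: "'a \<Rightarrow> real"
    show "0 \<le> quad {i, j} X v"
    proof (cases "i = j")
      case True
      then show ?thesis
        using n by (simp add: quad_def X_def)
    next
      case False
      then have "quad {i, j} X v = X i i * (v i)\<^sup>2 + 2 * v i * (X i j * v j) + X j j * (v j)\<^sup>2"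
        by (subst quad_insert) (auto simp: quad_def X_def power2_eq_square)
      also have "\<dots> = (if i \<in> K then if j \<in> K then (v i - v j)\<^sup>2 / n else (v i)\<^sup>2 / n
          else if j \<in> K then (v j)\<^sup>2 / n else 0)"
        using False n by (simp add: X_def power2_eq_square field_simps)
      also have "\<dots> \<ge> 0"
        using n by simp
      finally show ?thesis .
    qed
  qed
  then have edge: "X \<in> edgewise_psd E"
    using sym by (simp add: edgewise_psd_def)
  have "partial_trace V X = (\<Sum>i\<in>K. X i i)"
    unfolding partial_trace_def by (rule sum.mono_neutral_right) (use fin K in \<open>auto simp: X_def\<close>)
  also have "\<dots> = (\<Sum>i\<in>K. 1 / n)"
    by (intro sum.cong refl) (simp add: X_def)
  also have "\<dots> = 1"
    using n by (simp add: n_def)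
  finally have trace: "partial_trace V X = 1" .
  have "1 - 2 / n \<le> e" if e: "(\<lambda>i j. X i j + e * partial_id E i j) \<in> psd_completable V E" for e
  proof -
    obtain Y where Y: "psd_on V Y"
      "\<And>i j. {i, j} \<in> E \<Longrightarrow> Y i j = X i j + e * (if i = j then 1 else 0)"
      using e shift_completable_iff[OF G sym] by blast
    \<comment> \<open>The all-ones vector on \<open>K\<close> meets specified entries only, so the
      value \<open>n * (e - (1 - 2 / n))\<close> is the same for every completion.\<close>
    have "0 \<le> quad K Y (\<lambda>_. 1)"
      using psd_on_subset[OF Y(1) K(1) fin(1)] by (rule psd_on_quad_nonneg)
    also have "quad K Y (\<lambda>_. 1) = (\<Sum>i\<in>K. \<Sum>j\<in>K. (if i = j then 2 / n + e else 0) - 1 / n)"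
      unfolding quad_def by (intro sum.cong refl) (auto simp: Y(2) K_E X_def)
    also have "\<dots> = n * (2 / n + e) - n * (n * (1 / n))"
      using fin by (simp add: sum_subtractf right_diff_distrib flip: n_def)
    also have "\<dots> = n * (e - (1 - 2 / n))"
      using n by (simp add: field_simps)
    finally show ?thesis
      using n by (simp add: zero_le_mult_iff)
  qed
  then show ?thesis
    using that edge trace unfolding n_def by blast
qed

theorem theorem3p3:
  fixes V :: "'a set" and E :: "'a set set"
  assumes "graph V E" and "V \<noteq> {}"
  shows "1 - 2 / real (clique_number V E) \<le> eps_minus V E \<and>
         eps_minus V E \<le> 1 - 2 / (real (treewidth V E) + 1)"
proof -
  let ?C = "{X \<in> edgewise_psd E. partial_trace V X = 1}"
  have fin: "finite V"
    using assms by (simp add: graph_def)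
  have C_sym: "?C \<subseteq> partial_sym E"
    by (auto simp: edgewise_psd_def)
  obtain W F where H: "graph W F" "chordal W F" "subgraph V E W F"
    "clique_number W F = treewidth V E"
    using treewidth_attained[OF assms(1)] .
  have upper: "(\<lambda>i j. X i j + (1 - 2 / (real (treewidth V E) + 1)) * partial_id E i j)
      \<in> psd_completable V E" if "X \<in> ?C" for X
    using chordal_cover_completable[OF assms H(1-3)] that H(4) by auto
  obtain K where K: "K \<subseteq> V" "clique K E" "card K = clique_number V E"
    using clique_number_attained[OF fin] .
  then have "K \<noteq> {}"
    using clique_number_pos[OF fin assms(2), of E] by auto
  obtain X0 where X0: "X0 \<in> edgewise_psd E" "partial_trace V X0 = 1"
    and X0_lower: "\<And>e. (\<lambda>i j. X0 i j + e * partial_id E i j) \<in> psd_completable V E \<Longrightarrow>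
      1 - 2 / real (card K) \<le> e"
    by (rule clique_witness[OF assms(1) K(1,2) \<open>K \<noteq> {}\<close>]) blast
  have X0_C: "X0 \<in> ?C"
    using X0 by simp
  have "continuous_on ?C (psd_defect V E)"
    using upper by (intro continuous_on_psd_defect[OF assms C_sym]) blast
  then obtain X1 where X1: "X1 \<in> ?C" "\<And>X. X \<in> ?C \<Longrightarrow> psd_defect V E X \<le> psd_defect V E X1"
    using continuous_attains_sup[OF edgewise_psd_trace_compact[OF assms(1)]] X0_C by blast
  \<comment> \<open>\<open>GREATEST\<close> takes the intended value because the continuous defect
    attains its maximum over the compact set \<open>?C\<close> at \<open>X1\<close>.\<close>
  have eps: "eps_minus V E = psd_defect V E X1"
    unfolding eps_minus_def by (rule Greatest_equality) (use X1 in auto)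
  \<comment> \<open>\<open>upper\<close> enters twice: as the feasible shift that makes the minimum
    exist, and as the shift that bounds it.\<close>
  have "psd_defect V E X1 \<le> 1 - 2 / (real (treewidth V E) + 1)"
    by (rule psd_defect_attained(2)[OF assms subsetD[OF C_sym X1(1)] upper[OF X1(1)] upper[OF X1(1)]])
  moreover have "1 - 2 / real (clique_number V E) \<le> psd_defect V E X0"
    using X0_lower[OF psd_defect_attained(1)[OF assms subsetD[OF C_sym X0_C] upper[OF X0_C]]] K(3)
    by simp
  ultimately show ?thesis
    using X1(2)[OF X0_C] eps by simp
qed

end
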